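(* Let $(X,d)$ be a CAT$(0)$ space and let $T_1,T_2:X\to X$ satisfy property $(P_2)$ with $\mathrm{Fix}(S)\neq\emptyset$, where $S:=T_2\circ T_1$. Let $(\varepsilon_n),(\delta_n)$ be sequences of nonnegative reals with $\sum_{n=0}^\infty\varepsilon_n<\infty$ and $\sum_{n=0}^\infty\delta_n<\infty$, and put $\gamma_n:=\varepsilon_n+\delta_n$. Let $x_0\in X$ and let $(x_n),(y_n)$ be sequences in $X$ (with $(x_n)$ starting at $x_0$) satisfying $$d(y_n,T_1x_n)\le\varepsilon_n\quad\text{and}\quad d(x_{n+1},T_2y_n)\le\delta_n\qquad\text{for each } n\in\mathbb{N}.$$ Suppose that $\sum_{n=0}^\infty\gamma_n$ converges with Cauchy modulus $\alpha$, i.e., $\alpha:(0,\infty)\to\mathbb{N}$ and $$\forall\varepsilon>0\ \forall k\in\mathbb{N}\ \Bigl(\sum_{i=\alpha(\varepsilon)}^{\alpha(\varepsilon)+k}\gamma_i\le\varepsilon\Bigr).$$ Let $B\ge0$ be such that $\sum_{n\ge0}\gamma_n\le B$ and let $b>0$ be such that there exists $u\in\mathrm{Fix}(S)$ with $d(x_0,u)\le b$. Then $$\forall\varepsilon>0\ \forall n\ge\Phi'(\varepsilon,b,B,\alpha)\ \bigl(d(x_n,x_{n+1})\le\varepsilon\bigr),$$ where $$\Phi'(\varepsilon,b,B,\alpha):=\alpha(\varepsilon/3)+\Phi(\varepsilon/3,2(b+B)),$$ and, for $\eta,c>0$, $$\Phi(\eta,c):=K\left\lceil\frac{2c(1+2^K)}{\eta}\right\rceil+1\quad\text{with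 } K:=\left\lceil\frac{2c}{\eta}\right\rceil.$$ Moreover, with $\Phi''(\varepsilon,b,B,\alpha):=\Phi'(\varepsilon/2,b,B,\alpha)$, $$\forall\varepsilon>0\ \forall n\ge\Phi''(\varepsilon,b,B,\alpha)\ \bigl(d(y_n,y_{n+1})\le\varepsilon\bigr).$$
   Context: $\mathbb{N}=\{0,1,2,\dots\}$. A CAT$(0)$ space is a geodesic metric space $(X,d)$ (any two points are joined by a geodesic path) satisfying, for all $x,y,u,v\in X$, $d(x,y)^2+d(u,v)^2\le d(x,v)^2+d(y,u)^2+2d(x,u)d(y,v)$ (this is equivalent to the usual definition). A mapping $T:X\to X$ satisfies property $(P_2)$ if $2d(Tx,Ty)^2\le d(x,Ty)^2+d(y,Tx)^2-d(x,Tx)^2-d(y,Ty)^2$ for all $x,y\in X$. $\mathrm{Fix}(S)=\{x\in X: Sx=x\}$. *)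

theory Defs
  imports "HOL-Analysis.Analysis"
begin

context Metric_space
begin

definition geodesic_path :: "(real \<Rightarrow> 'a) \<Rightarrow> real \<Rightarrow> 'a \<Rightarrow> 'a \<Rightarrow> bool" where
  "geodesic_path c l x y \<longleftrightarrow>
     0 \<le> l \<and> c \<in> {0..l} \<rightarrow> M \<and> c 0 = x \<and> c l = y \<and>
     (\<forall>s\<in>{0..l}. \<forall>t\<in>{0..l}. d (c s) (c t) = \<bar>s - t\<bar>)"

definition property_P2 :: "('a \<Rightarrow> 'a) \<Rightarrow> bool" where
  "property_P2 T \<longleftrightarrow>
     (\<forall>x\<in>M. \<forall>y\<in>M.
        2 * (d (T x) (T y))\<^sup>2 \<le> (d x (T y))\<^sup>2 + (d y (T x))\<^sup>2 - (d x (T x))\<^sup>2 - (d y (T y))\<^sup>2)"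

end

locale geodesic_space = Metric_space +
  assumes geodesic: "\<lbrakk>x \<in> M; y \<in> M\<rbrakk> \<Longrightarrow> \<exists>c l. geodesic_path c l x y"

text \<open>CAT(0) spaces are the geodesic spaces in which the quadrilateral (Berg--Nikolaev
  quasilinearization) inequality holds.\<close>

locale CAT0_space = geodesic_space +
  assumes quadrilateral:
    "\<lbrakk>x \<in> M; y \<in> M; u \<in> M; v \<in> M\<rbrakk> \<Longrightarrow>
       (d x y)\<^sup>2 + (d u v)\<^sup>2 \<le> (d x v)\<^sup>2 + (d y u)\<^sup>2 + 2 * d x u * d y v"

definition Fix :: "'a set \<Rightarrow> ('a \<Rightarrow> 'a) \<Rightarrow> 'a set" where
  "Fix X S = {x \<in> X. S x = x}"

text \<open>Only the values of the modulus at positive arguments matter.\<close>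

definition series_Cauchy_modulus :: "(nat \<Rightarrow> real) \<Rightarrow> (real \<Rightarrow> nat) \<Rightarrow> bool" where
  "series_Cauchy_modulus \<gamma> \<alpha> \<longleftrightarrow>
     (\<forall>\<epsilon>>0. \<forall>k. (\<Sum>i = \<alpha> \<epsilon>..\<alpha> \<epsilon> + k. \<gamma> i) \<le> \<epsilon>)"

text \<open>The rates below are used for positive \<open>\<eta>\<close>, \<open>c\<close>, \<open>\<epsilon>\<close>; the ceilings are then
  positive, so that \<open>nat\<close> does not truncate.\<close>

definition Phi :: "real \<Rightarrow> real \<Rightarrow> nat" where
  "Phi \<eta> c = (let K = nat \<lceil>2 * c / \<eta>\<rceil> in K * nat \<lceil>2 * c * (1 + 2 ^ K) / \<eta>\<rceil> + 1)"

definition Phi' :: "real \<Rightarrow> real \<Rightarrow> real \<Rightarrow> (real \<Rightarrow> nat) \<Rightarrow> nat" where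
  "Phi' \<epsilon> b B \<alpha> = \<alpha> (\<epsilon> / 3) + Phi (\<epsilon> / 3) (2 * (b + B))"

definition Phi'' :: "real \<Rightarrow> real \<Rightarrow> real \<Rightarrow> (real \<Rightarrow> nat) \<Rightarrow> nat" where
  "Phi'' \<epsilon> b B \<alpha> = Phi' (\<epsilon> / 2) b B \<alpha>"

end

theory Submission
  imports Defs
begin

text \<open>
  Let \<open>S = T2 \<circ> T1\<close>. Adding the inequalities \<open>(P\<^sub>2)\<close> for \<open>T1\<close> at \<open>x, x'\<close> and for \<open>T2\<close> at
  \<open>T1 x, T1 x'\<close>, and estimating the right-hand side by two quadrilateral inequalities, gives

  \<open>D\<^sup>2 + D'\<^sup>2 \<le> (d x (S x') + d x' (S x)) * D\<close>

  with \<open>D = d (T1 x) (T1 x')\<close> and \<open>D' = d (S x) (S x')\<close>. Since \<open>2 * D * D' \<le> D\<^sup>2 + D'\<^sup>2\<close>, this yields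
  the key inequality about \<open>S\<close> (\<open>P2_comp_midpoint\<close>):

  \<open>2 * d (S x) (S x') \<le> d x (S x') + d x' (S x)\<close>

  Along an orbit \<open>z\<close> of \<open>S\<close>, write \<open>E n k = d (z n) (z (n + k))\<close>. The inequality becomes
  \<open>E n (k + 1) \<ge> 2 * E (n + 1) k - E (n + 1) (k - 1)\<close>: where consecutive steps have almost equal
  length \<open>r\<close>, the orbit runs almost straight, so that \<open>E n k\<close> is close to \<open>k * r\<close>
  (\<open>almost_straight\<close>). Step lengths never increase, so by the pigeonhole principle there are long windows
  on which they are almost constant. As an orbit stays within distance \<open>c\<close> of a fixed point, all
  \<open>E n k\<close> are at most \<open>2 * c\<close>, and a long straight window is possible only if \<open>r\<close> is small.
  Counting the length and the number of windows gives the rate \<open>Phi\<close>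
  (\<open>asymptotic_regularity_rate\<close>).

  For inexact iterates, the exact orbit is started at \<open>x (\<alpha> (e / 3))\<close>. From there on, the total
  error is at most \<open>e / 3\<close>, \<open>S\<close> is nonexpansive, and so \<open>x\<close> stays within \<open>e / 3\<close> of that orbit,
  whose steps are eventually at most \<open>e / 3\<close>. The starting point is within \<open>b + B\<close> of the fixed
  point since the errors made before it sum up to at most \<open>B\<close>. The claim about \<open>y\<close> follows from the one
  about \<open>x\<close> because \<open>T1\<close> is nonexpansive, the errors of the two comparisons being small again.
\<close>

section \<open>Compositions of two mappings with property \<open>(P\<^sub>2)\<close>\<close>

context CAT0_space
begin

lemma P2_nonexpansive:
  assumes T: "T \<in> M \<rightarrow> M" and P2: "property_P2 T" and x: "x \<in> M" and y: "y \<in> M"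
  shows "d (T x) (T y) \<le> d x y"
proof -
  have Tx: "T x \<in> M" and Ty: "T y \<in> M"
    using T x y by auto
  have "2 * (d (T x) (T y))\<^sup>2 \<le> (d x (T y))\<^sup>2 + (d y (T x))\<^sup>2 - (d x (T x))\<^sup>2 - (d y (T y))\<^sup>2"
    using P2 x y by (simp add: property_P2_def)
  moreover have "(d x (T y))\<^sup>2 + (d y (T x))\<^sup>2 \<le> (d x (T x))\<^sup>2 + (d (T y) y)\<^sup>2 + 2 * d x y * d (T y) (T x)"
    using quadrilateral[OF x Ty y Tx] by simp
  ultimately have "d (T x) (T y) * d (T x) (T y) \<le> d x y * d (T x) (T y)"
    using commute[of y "T y"] commute[of "T x" "T y"] by (simp add: power2_eq_square)
  then show ?thesis
    using nonneg[of "T x" "T y"] nonneg[of x y]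
    by (cases "d (T x) (T y) = 0") (simp_all add: mult_le_cancel_right del: zero)
qed

text \<open>
  The two inequalities \<open>(P\<^sub>2)\<close> have eight squared distances on their right-hand sides. They split
  into two groups, each being the defect of a quadrilateral that has \<open>T1 x\<close> and \<open>T1 x'\<close> as
  vertices, so that \<open>d (T1 x) (T1 x')\<close> becomes a common factor of both bounds.
\<close>
lemma P2_comp_midpoint:
  assumes T1: "T1 \<in> M \<rightarrow> M" and T2: "T2 \<in> M \<rightarrow> M"
    and P1: "property_P2 T1" and P2: "property_P2 T2"
    and x: "x \<in> M" and x': "x' \<in> M"
  shows "2 * d (T2 (T1 x)) (T2 (T1 x')) \<le> d x (T2 (T1 x')) + d x' (T2 (T1 x))"
proof -
  define y y' z z' where "y = T1 x" and "y' = T1 x'" and "z = T2 y" and "z' = T2 y'"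
  note defs = this
  have M: "y \<in> M" "y' \<in> M" "z \<in> M" "z' \<in> M"
    using T1 T2 x x' by (auto simp: defs)
  have "2 * (d y y')\<^sup>2 \<le> (d x y')\<^sup>2 + (d x' y)\<^sup>2 - (d x y)\<^sup>2 - (d x' y')\<^sup>2"
    using P1 x x' by (simp add: property_P2_def defs)
  moreover have "2 * (d z z')\<^sup>2 \<le> (d y z')\<^sup>2 + (d y' z)\<^sup>2 - (d y z)\<^sup>2 - (d y' z')\<^sup>2"
    using P2 M by (simp add: property_P2_def defs)
  moreover have "(d x y')\<^sup>2 + (d y z')\<^sup>2 \<le> (d x y)\<^sup>2 + (d y' z')\<^sup>2 + 2 * d x z' * d y y'"
    using quadrilateral[OF x M(2,4,1)] by (simp add: commute)
  moreover have "(d x' y)\<^sup>2 + (d y' z)\<^sup>2 \<le> (d x' y')\<^sup>2 + (d y z)\<^sup>2 + 2 * d x' z * d y y'"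
    using quadrilateral[OF x' M(1,3,2)] by (simp add: commute)
  ultimately have sum: "(d y y')\<^sup>2 + (d z z')\<^sup>2 \<le> (d x z' + d x' z) * d y y'"
    by (simp add: algebra_simps)
  show ?thesis
  proof (cases "d y y' = 0")
    case True
    then have "z = z'"
      using M by (simp add: defs)
    then show ?thesis
      using M by (simp add: defs[symmetric])
  next
    case False
    have "0 \<le> (d y y' - d z z')\<^sup>2" by simp
    then have "(2 * d z z') * d y y' \<le> (d x z' + d x' z) * d y y'"
      using sum by (simp add: power2_diff mult_ac)
    then have "2 * d z z' \<le> d x z' + d x' z"
      using False nonneg[of y y'] by (simp add: mult_le_cancel_right)
    then show ?thesis by (simp add: defs)
  qed
qed

end

section \<open>Rate of asymptotic regularity\<close>

context Metric_space
begin

text \<open>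
  For \<open>k = 0\<close> nothing is lost. Passing from \<open>k\<close> to \<open>k + 1\<close> doubles the loss and adds
  \<open>k * \<theta>\<close>, because the subtracted distance spans \<open>k\<close> steps, each possibly longer than \<open>r\<close> by
  \<open>\<theta>\<close>. The coefficients \<open>2 ^ k - (k + 1)\<close> solve this recursion.
\<close>
lemma almost_straight:
  fixes z :: "nat \<Rightarrow> 'a" and r \<theta> :: real
  assumes zM: "\<And>n. z n \<in> M"
    and mid: "\<And>i j. 2 * d (z (Suc i)) (z (Suc j)) \<le> d (z i) (z (Suc j)) + d (z j) (z (Suc i))"
    and low: "\<And>i. p \<le> i \<Longrightarrow> i \<le> q \<Longrightarrow> r \<le> d (z i) (z (Suc i))"
    and up: "\<And>i. p \<le> i \<Longrightarrow> i \<le> q \<Longrightarrow> d (z i) (z (Suc i)) \<le> r + \<theta>"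
  shows "p \<le> n \<Longrightarrow> n + k \<le> q \<Longrightarrow>
    real (k + 1) * r - (2 ^ k - real (k + 1)) * \<theta> \<le> d (z n) (z (Suc (n + k)))"
proof (induction k arbitrary: n)
  case 0
  then show ?case using low[of n] by simp
next
  case (Suc k)
  have path: "d (z m) (z (m + j)) \<le> real j * (r + \<theta>)" if "p \<le> m" "m + j \<le> Suc q" for m j
    using that
  proof (induction j)
    case 0
    then show ?case using zM by simp
  next
    case (Suc j)
    then have "d (z (m + j)) (z (Suc (m + j))) \<le> r + \<theta>"
      by (intro up) auto
    moreover have "d (z m) (z (Suc (m + j))) \<le> d (z m) (z (m + j)) + d (z (m + j)) (z (Suc (m + j)))"
      using triangle zM by blast
    ultimately show ?case
      using Suc by (simp add: algebra_simps)
  qed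
  define lower upper where "lower = real (k + 1) * r - (2 ^ k - real (k + 1)) * \<theta>"
    and "upper = real k * (r + \<theta>)"
  have "lower \<le> d (z (Suc n)) (z (Suc (Suc n + k)))"
    unfolding lower_def using Suc by (intro Suc.IH) auto
  moreover have "d (z (Suc n)) (z (Suc n + k)) \<le> upper"
    unfolding upper_def using Suc.prems by (intro path) auto
  moreover have "2 * d (z (Suc n)) (z (Suc (Suc n + k)))
      \<le> d (z n) (z (Suc (Suc n + k))) + d (z (Suc n)) (z (Suc n + k))"
    using mid[of n "Suc n + k"] by (simp add: commute)
  ultimately have "2 * lower - upper \<le> d (z n) (z (Suc (Suc n + k)))"
    by linarith
  then show ?case by (simp add: lower_def upper_def algebra_simps)
qed

text \<open>
  Suppose that a step longer than \<open>\<eta>\<close> occurs after \<open>L\<close> windows of length \<open>K\<close>. All steps have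
  length at most \<open>2 * c \<le> L * \<theta>\<close> with \<open>\<theta> = \<eta> / (1 + 2 ^ K)\<close>, so on one of the windows the step
  lengths vary by at most \<open>\<theta>\<close>. Then the two ends of its \<open>K + 1\<close> steps are more than \<open>(K + 1) * \<eta> - 2 ^ K * \<theta> > K * \<eta> \<ge> 2 * c\<close> apart.
\<close>
lemma asymptotic_regularity_rate:
  fixes S :: "'a \<Rightarrow> 'a" and \<eta> c :: real
  assumes S: "S \<in> M \<rightarrow> M"
    and nonexp: "\<And>x y. x \<in> M \<Longrightarrow> y \<in> M \<Longrightarrow> d (S x) (S y) \<le> d x y"
    and mid: "\<And>x y. x \<in> M \<Longrightarrow> y \<in> M \<Longrightarrow> 2 * d (S x) (S y) \<le> d x (S y) + d y (S x)"
    and x: "x \<in> M" and u: "u \<in> M" "S u = u" and xu: "d x u \<le> c"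
    and \<eta>: "0 < \<eta>" and n: "Phi \<eta> c \<le> n"
  shows "d ((S ^^ n) x) ((S ^^ Suc n) x) \<le> \<eta>"
proof (rule ccontr)
  assume long: "\<not> ?thesis"
  define z where "z i = (S ^^ i) x" for i
  define a where "a i = d (z i) (z (Suc i))" for i
  define K where "K = nat \<lceil>2 * c / \<eta>\<rceil>"
  define L where "L = nat \<lceil>2 * c * (1 + 2 ^ K) / \<eta>\<rceil>"
  define \<theta> where "\<theta> = \<eta> / (1 + 2 ^ K)"
  have pos: "(0::real) < 1 + 2 ^ K"
    by (simp add: add_pos_pos)
  then have \<theta>: "0 < \<theta>"
    using \<eta> by (simp add: \<theta>_def)
  have z_Suc: "z (Suc i) = S (z i)" for i
    by (simp add: z_def)
  have zM: "z i \<in> M" for i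
    using S x by (induction i) (auto simp: z_def)
  have zu: "d (z i) u \<le> c" for i
  proof (induction i)
    case 0
    then show ?case using xu by (simp add: z_def)
  next
    case (Suc i)
    then show ?case
      using nonexp[OF zM u(1), of i] u(2) by (simp add: z_Suc)
  qed
  have bound: "d (z i) (z j) \<le> 2 * c" for i j
    using triangle[of "z i" u "z j"] zM u(1) zu[of i] zu[of j] by (simp add: commute)
  have "decseq a"
    using nonexp[OF zM zM] by (intro decseq_SucI) (simp add: a_def flip: z_Suc)
  have n_bd: "K * L + 1 \<le> n"
    using n by (simp add: Phi_def Let_def K_def L_def)
  have a_n: "\<eta> < a n"
    using long by (simp add: a_def z_def)
  have K: "2 * c \<le> real K * \<eta>"
  proof -
    have "2 * c / \<eta> \<le> real K" unfolding K_def by linarith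
    then show ?thesis using \<eta> by (simp add: field_simps)
  qed
  have L: "2 * c \<le> real L * \<theta>"
  proof -
    have "2 * c * (1 + 2 ^ K) / \<eta> \<le> real L" unfolding L_def by linarith
    then show ?thesis using \<eta> pos by (simp add: \<theta>_def field_simps)
  qed
  have "\<exists>j<L. a (K * j) - a (K * Suc j) \<le> \<theta>"
  proof (rule ccontr)
    assume "\<not> ?thesis"
    then have "(\<Sum>j<L. \<theta>) \<le> (\<Sum>j<L. a (K * j) - a (K * Suc j))"
      by (intro sum_mono) force
    also have "\<dots> = a 0 - a (K * L)"
      by (simp add: sum_lessThan_telescope'[of "\<lambda>j. a (K * j)"] del: mult_Suc_right)
    finally have "real L * \<theta> \<le> a 0 - a (K * L)" by simp
    moreover have "a n \<le> a (K * L)"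
      using \<open>decseq a\<close> n_bd by (auto simp: decseq_def)
    ultimately show False
      using L a_n \<eta> bound[of 0 "Suc 0"] by (simp add: a_def)
  qed
  then obtain j where j: "j < L" and drop: "a (K * j) - a (K * Suc j) \<le> \<theta>"
    by blast
  define r where "r = a (K * Suc j)"
  have "a n \<le> r"
  proof -
    have "K * Suc j \<le> K * L" using j by (intro mult_le_mono2) simp
    then show ?thesis
      using \<open>decseq a\<close> n_bd unfolding r_def decseq_def by (meson add_leD1 le_trans)
  qed
  then have r: "\<eta> < r" using a_n by simp
  have "real (K + 1) * r - (2 ^ K - real (K + 1)) * \<theta> \<le> d (z (K * j)) (z (Suc (K * j + K)))"
  proof (rule almost_straight[where p = "K * j" and q = "K * Suc j"])
    show "z i \<in> M" for i by (rule zM)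
    show "2 * d (z (Suc i)) (z (Suc l)) \<le> d (z i) (z (Suc l)) + d (z l) (z (Suc i))" for i l
      unfolding z_Suc by (intro mid zM)
    show "r \<le> d (z i) (z (Suc i))" if "K * j \<le> i" "i \<le> K * Suc j" for i
      using decseqD[OF \<open>decseq a\<close> that(2)] by (simp add: r_def a_def)
    show "d (z i) (z (Suc i)) \<le> r + \<theta>" if "K * j \<le> i" "i \<le> K * Suc j" for i
      using decseqD[OF \<open>decseq a\<close> that(1)] drop by (simp add: r_def a_def)
  qed auto
  moreover have "real (K + 1) * \<eta> < real (K + 1) * r"
    using r by simp
  moreover have "(2 ^ K - real (K + 1)) * \<theta> < (1 + 2 ^ K) * \<theta>"
    using \<theta> by (intro mult_strict_right_mono) auto
  moreover have "(1 + 2 ^ K) * \<theta> = \<eta>"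
    using pos by (simp add: \<theta>_def)
  ultimately have "2 * c < d (z (K * j)) (z (Suc (K * j + K)))"
    using K by (simp add: algebra_simps)
  then show False
    using bound[of "K * j" "Suc (K * j + K)"] by simp
qed

section \<open>Inexact orbits\<close>

lemma inexact_orbit_deviation:
  assumes S: "S \<in> M \<rightarrow> M"
    and nonexp: "\<And>x y. x \<in> M \<Longrightarrow> y \<in> M \<Longrightarrow> d (S x) (S y) \<le> d x y"
    and xM: "\<And>n. x n \<in> M" and err: "\<And>n. d (x (Suc n)) (S (x n)) \<le> \<gamma> n"
    and u: "u \<in> M"
  shows "d (x (m + k)) ((S ^^ k) u) \<le> d (x m) u + (\<Sum>i = m..<m + k. \<gamma> i)"
proof (induction k)
  case 0
  then show ?case by simp
next
  case (Suc k)
  have M: "(S ^^ k) u \<in> M" for k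
    using S u by (induction k) auto
  have "d (x (Suc (m + k))) (S ((S ^^ k) u))
      \<le> d (x (Suc (m + k))) (S (x (m + k))) + d (S (x (m + k))) (S ((S ^^ k) u))"
    using triangle S xM M by blast
  also have "\<dots> \<le> \<gamma> (m + k) + d (x (m + k)) ((S ^^ k) u)"
    by (intro add_mono err nonexp xM M)
  finally show ?case
    using Suc by simp
qed

end

theorem theorem3p3:
  fixes X :: "'a set" and d :: "'a \<Rightarrow> 'a \<Rightarrow> real"
    and T1 T2 S :: "'a \<Rightarrow> 'a"
    and \<epsilon> \<delta> \<gamma> :: "nat \<Rightarrow> real"
    and x y :: "nat \<Rightarrow> 'a"
    and \<alpha> :: "real \<Rightarrow> nat" and b B :: real
  assumes "CAT0_space X d"
    and "T1 \<in> X \<rightarrow> X" and "T2 \<in> X \<rightarrow> X"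
    and "Metric_space.property_P2 X d T1" and "Metric_space.property_P2 X d T2"
    and "S = T2 \<circ> T1" and "Fix X S \<noteq> {}"
    and "\<And>n. 0 \<le> \<epsilon> n" and "\<And>n. 0 \<le> \<delta> n"
    and "summable \<epsilon>" and "summable \<delta>"
    and "\<And>n. \<gamma> n = \<epsilon> n + \<delta> n"
    and "\<And>n. x n \<in> X" and "\<And>n. y n \<in> X"
    and "\<And>n. d (y n) (T1 (x n)) \<le> \<epsilon> n"
    and "\<And>n. d (x (Suc n)) (T2 (y n)) \<le> \<delta> n"
    and "series_Cauchy_modulus \<gamma> \<alpha>"
    and "0 \<le> B" and "(\<Sum>n. \<gamma> n) \<le> B"
    and "0 < b" and "\<exists>u\<in>Fix X S. d (x 0) u \<le> b"
  shows "(\<forall>e>0. \<forall>n\<ge>Phi' e b B \<alpha>. d (x n) (x (Suc n)) \<le> e) \<and>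
         (\<forall>e>0. \<forall>n\<ge>Phi'' e b B \<alpha>. d (y n) (y (Suc n)) \<le> e)"
proof -
  interpret CAT0_space X d by fact
  note T1 = \<open>T1 \<in> X \<rightarrow> X\<close> and T2 = \<open>T2 \<in> X \<rightarrow> X\<close>
    and P1 = \<open>property_P2 T1\<close> and P2 = \<open>property_P2 T2\<close>
    and xX = \<open>\<And>n. x n \<in> X\<close> and yX = \<open>\<And>n. y n \<in> X\<close>
  note ne1 = P2_nonexpansive[OF T1 P1] and ne2 = P2_nonexpansive[OF T2 P2]
  have S: "S \<in> X \<rightarrow> X"
    using T1 T2 \<open>S = T2 \<circ> T1\<close> by auto
  have nonexp: "d (S v) (S w) \<le> d v w" if "v \<in> X" "w \<in> X" for v w
    using ne1[OF that] ne2[of "T1 v" "T1 w"] that T1 \<open>S = T2 \<circ> T1\<close> by force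
  have mid: "2 * d (S v) (S w) \<le> d v (S w) + d w (S v)" if "v \<in> X" "w \<in> X" for v w
    using P2_comp_midpoint[OF T1 T2 P1 P2 that] \<open>S = T2 \<circ> T1\<close> by simp
  have \<gamma>_nonneg: "0 \<le> \<gamma> n" for n
    using assms(8,9,12) by simp
  have "summable \<gamma>"
    using summable_add[OF \<open>summable \<epsilon>\<close> \<open>summable \<delta>\<close>] by (simp flip: assms(12))
  have err: "d (x (Suc n)) (S (x n)) \<le> \<gamma> n" for n
  proof -
    have M: "T1 (x n) \<in> X" "T2 (y n) \<in> X" "T2 (T1 (x n)) \<in> X"
      using T1 T2 xX yX by auto
    have "d (x (Suc n)) (T2 (T1 (x n))) \<le> d (x (Suc n)) (T2 (y n)) + d (T2 (y n)) (T2 (T1 (x n)))"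
      using triangle xX M by blast
    also have "\<dots> \<le> \<delta> n + \<epsilon> n"
      using assms(15,16)[of n] ne2[OF yX M(1), of n] by linarith
    finally show ?thesis
      using assms(12) \<open>S = T2 \<circ> T1\<close> by simp
  qed
  have deviation: "d (x (m + k)) ((S ^^ k) v) \<le> d (x m) v + sum \<gamma> {m..<m + k}" if "v \<in> X" for v m k
    using that by (intro inexact_orbit_deviation[OF S] nonexp xX err)
  have \<gamma>_tail: "sum \<gamma> I \<le> e" if "0 < e" "finite I" "I \<subseteq> {\<alpha> e..}" for e I
  proof -
    obtain k where "\<forall>i\<in>I. i \<le> k"
      using \<open>finite I\<close> finite_nat_set_iff_bounded_le by blast
    then have "I \<subseteq> {\<alpha> e..\<alpha> e + k}"
      using that(3) by (fastforce intro: trans_le_add2)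
    then have "sum \<gamma> I \<le> sum \<gamma> {\<alpha> e..\<alpha> e + k}"
      using \<gamma>_nonneg by (intro sum_mono2) auto
    also have "\<dots> \<le> e"
      using \<open>series_Cauchy_modulus \<gamma> \<alpha>\<close> that(1) by (simp add: series_Cauchy_modulus_def)
    finally show ?thesis .
  qed
  obtain u where u: "u \<in> X" "S u = u" and x0u: "d (x 0) u \<le> b"
    using assms(21) by (auto simp: Fix_def)
  have xu: "d (x m) u \<le> b + B" for m
  proof -
    have fixed: "(S ^^ m) u = u"
      using u(2) by (induction m) auto
    have "sum \<gamma> {..<m} \<le> suminf \<gamma>"
      using \<open>summable \<gamma>\<close> \<gamma>_nonneg by (intro sum_le_suminf) auto
    then show ?thesis
      using deviation[of u 0 m, OF u(1)] x0u fixed \<open>suminf \<gamma> \<le> B\<close>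
      by (simp add: lessThan_atLeast0)
  qed

  have x_rate: "d (x n) (x (Suc n)) \<le> e" if e: "0 < e" and n: "Phi' e b B \<alpha> \<le> n" for e n
  proof -
    define m where "m = \<alpha> (e / 3)"
    define k where "k = n - m"
    have n_eq: "n = m + k" and k: "Phi (e / 3) (2 * (b + B)) \<le> k"
      using n by (simp_all add: Phi'_def m_def k_def)
    have M: "(S ^^ i) (x m) \<in> X" for i
      using S xX by (induction i) auto
    have close: "d (x (m + i)) ((S ^^ i) (x m)) \<le> e / 3" for i
    proof -
      have "sum \<gamma> {m..<m + i} \<le> e / 3"
        using e by (intro \<gamma>_tail) (auto simp: m_def)
      then show ?thesis
        using deviation[of "x m" m i, OF xX] xX by simp
    qed
    have "d (x m) u \<le> 2 * (b + B)"
      using xu[of m] \<open>0 < b\<close> \<open>0 \<le> B\<close> by simp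
    with k have "d ((S ^^ k) (x m)) ((S ^^ Suc k) (x m)) \<le> e / 3"
      using e u by (intro asymptotic_regularity_rate[OF S] nonexp mid xX) auto
    moreover have "d (x n) (x (Suc n)) \<le> d (x n) ((S ^^ k) (x m))
        + d ((S ^^ k) (x m)) ((S ^^ Suc k) (x m)) + d (x (Suc n)) ((S ^^ Suc k) (x m))"
      using triangle[OF xX[of n] M[of k] xX[of "Suc n"]]
        triangle[OF M[of k] M[of "Suc k"] xX[of "Suc n"]]
        commute[of "x (Suc n)" "(S ^^ Suc k) (x m)"] by linarith
    ultimately show ?thesis
      using close[of k] close[of "Suc k"] by (simp add: n_eq)
  qed

  have y_rate: "d (y n) (y (Suc n)) \<le> e" if e: "0 < e" and n: "Phi'' e b B \<alpha> \<le> n" for e n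
  proof -
    have TM: "T1 (x i) \<in> X" for i
      using T1 xX by auto
    \<comment> \<open>The summand \<open>\<alpha> (e / 2 / 3)\<close> of the rate also makes the errors at \<open>n\<close> and \<open>n + 1\<close> small.\<close>
    have "\<alpha> (e / 6) \<le> n"
      using n by (simp add: Phi''_def Phi'_def)
    then have "sum \<gamma> {n, Suc n} \<le> e / 6"
      using e by (intro \<gamma>_tail) auto
    then have "\<epsilon> n + \<epsilon> (Suc n) \<le> e / 6"
      using assms(9)[of n] assms(9)[of "Suc n"] by (simp add: assms(12))
    moreover have "d (T1 (x n)) (T1 (x (Suc n))) \<le> e / 2"
      using ne1[OF xX xX, of n "Suc n"] x_rate[of "e / 2" n] e n by (simp add: Phi''_def)
    moreover have "d (y n) (y (Suc n))
        \<le> d (y n) (T1 (x n)) + d (T1 (x n)) (T1 (x (Suc n))) + d (y (Suc n)) (T1 (x (Suc n)))"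
      using triangle[OF yX[of n] TM[of n] yX[of "Suc n"]]
        triangle[OF TM[of n] TM[of "Suc n"] yX[of "Suc n"]]
        commute[of "y (Suc n)" "T1 (x (Suc n))"] by linarith
    ultimately show ?thesis
      using assms(15)[of n] assms(15)[of "Suc n"] e by linarith
  qed
  show ?thesis
    using x_rate y_rate by blast
qed

end
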